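(* Let $G$ be a graph and let $\xi$ be a four-coloring of $G$, that is, a graph homomorphism from $G$ to $K_4$. Let $$ r_{\phi_1}r_{\phi_2}\cdots r_{\phi_d}-r_{\phi_1'}r_{\phi_2'}\cdots r_{\phi_d'} $$ be a binomial without common variables (no variable divides both monomials) in $I_{K_3\to G}$. If $d<12$, then there exists a permutation $\pi\in\mathcal{S}_d$ such that $\xi\circ\phi_i=\xi\circ\phi'_{\pi(i)}$ for all $i\in\{1,\dots,d\}$.
   Context: Graphs are finite and undirected without multiple edges. $K_n$ is the complete loopless graph on $n$ vertices. $\mathrm{Hom}(G,H)$ is the set of graph homomorphisms, i.e. maps $\phi:V(G)\to V(H)$ with $\phi(u)\phi(v)\in E(H)$ whenever $uv\in E(G)$. Fix a field $\mathbf{k}$. For $e\in E(G)$ let $G[e]$ be the subgraph consisting only of $e$ and its endpoint(s). Put $R_{G\to H}=\mathbf{k}[r_\phi : \phi\in\mathrm{Hom}(G,H)]$ and $S_{G\to H}=\mathbf{k}[s_\psi : e\in E(G),\ \psi\in \mathrm{Hom}(G[e],H)]$. Let $\Phi_{G\to H}:R_{G\to H}\to S_{G\to H}$ be the $\mathbf{k}$-algebra map with $\Phi(r_\phi)=\prod_{e\in E(G)} s_{\phi|_e}$, and $I_{G\to H}=\ker\Phi_{G\to H}$. Here the $\phi_i,\phi_i'$ are elements of $\mathrm{Hom}(K_3,G)$. *)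

theory Defs
  imports "HOL-Library.FuncSet" "HOL-Library.Poly_Mapping" "HOL-Combinatorics.Permutations"
begin

record 'a ugraph =
  verts :: "'a set"
  edges :: "'a set set"

text \<open>An edge is the set of its endpoints; a loop at \<open>v\<close> is the singleton \<open>{v}\<close>.\<close>

definition is_graph :: "'a ugraph \<Rightarrow> bool" where
  "is_graph G \<longleftrightarrow> finite (verts G) \<and> (\<forall>e\<in>edges G. e \<subseteq> verts G \<and> card e \<in> {1, 2})"

definition complete_graph :: "nat \<Rightarrow> nat ugraph" where
  "complete_graph n =
     \<lparr>verts = {1..n}, edges = {{u, v} | u v. u \<in> {1..n} \<and> v \<in> {1..n} \<and> u \<noteq> v}\<rparr>"

definition edge_subgraph :: "'a set \<Rightarrow> 'a ugraph" where
  "edge_subgraph e = \<lparr>verts = e, edges = {e}\<rparr>"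

text \<open>Homomorphisms are extensional on \<open>verts G\<close>, so each of them is represented exactly once.\<close>

definition Hom :: "'a ugraph \<Rightarrow> 'b ugraph \<Rightarrow> ('a \<Rightarrow> 'b) set" where
  "Hom G H = {\<phi> \<in> verts G \<rightarrow>\<^sub>E verts H. \<forall>u v. {u, v} \<in> edges G \<longrightarrow> {\<phi> u, \<phi> v} \<in> edges H}"

text \<open>
  Polynomials with coefficients in \<open>'k\<close> and variables from the whole type \<open>'x\<close>; a monomial is
  its finitely supported exponent function. \<open>poly_ring X\<close> is the subring $k[x : x \in X]$.
\<close>

type_synonym ('x, 'k) mpoly = "('x \<Rightarrow>\<^sub>0 nat) \<Rightarrow>\<^sub>0 'k"

definition Var :: "'x \<Rightarrow> ('x, 'k::field) mpoly" where
  "Var x = Poly_Mapping.single (Poly_Mapping.single x 1) 1"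

definition Const :: "'k \<Rightarrow> ('x, 'k::field) mpoly" where
  "Const c = Poly_Mapping.single 0 c"

definition poly_ring :: "'x set \<Rightarrow> ('x, 'k::field) mpoly set" where
  "poly_ring X = {p. \<forall>m\<in>Poly_Mapping.keys p. Poly_Mapping.keys m \<subseteq> X}"

definition mon_subst :: "('x \<Rightarrow> ('y, 'k::field) mpoly) \<Rightarrow> ('x \<Rightarrow>\<^sub>0 nat) \<Rightarrow> ('y, 'k) mpoly" where
  "mon_subst f m = (\<Prod>x\<in>Poly_Mapping.keys m. f x ^ Poly_Mapping.lookup m x)"

definition poly_subst :: "('x \<Rightarrow> ('y, 'k::field) mpoly) \<Rightarrow> ('x, 'k) mpoly \<Rightarrow> ('y, 'k) mpoly" where
  "poly_subst f p = (\<Sum>m\<in>Poly_Mapping.keys p. Const (Poly_Mapping.lookup p m) * mon_subst f m)"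

definition hom_ring :: "'a ugraph \<Rightarrow> 'b ugraph \<Rightarrow> ('a \<Rightarrow> 'b, 'k::field) mpoly set" where
  "hom_ring G H = poly_ring (Hom G H)"

text \<open>
  The index of a variable of \<open>edge_ring G H\<close> records the edge \<open>e\<close> besides \<open>\<psi>\<close>: the function \<open>\<psi>\<close>
  alone need not determine its domain, since a value may coincide with \<open>undefined\<close>.
\<close>

definition edge_ring :: "'a ugraph \<Rightarrow> 'b ugraph \<Rightarrow> ('a set \<times> ('a \<Rightarrow> 'b), 'k::field) mpoly set" where
  "edge_ring G H = poly_ring (SIGMA e:edges G. Hom (edge_subgraph e) H)"

definition Phi :: "'a ugraph \<Rightarrow> ('a \<Rightarrow> 'b, 'k::field) mpoly \<Rightarrow> ('a set \<times> ('a \<Rightarrow> 'b), 'k) mpoly" where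
  "Phi G = poly_subst (\<lambda>\<phi>. \<Prod>e\<in>edges G. Var (e, restrict \<phi> e))"

definition hom_ideal :: "'a ugraph \<Rightarrow> 'b ugraph \<Rightarrow> ('a \<Rightarrow> 'b, 'k::field) mpoly set" where
  "hom_ideal G H = {p \<in> hom_ring G H. Phi G p = 0}"

text \<open>
  \<open>Phi G\<close> is the \<open>'k\<close>-algebra map from \<open>hom_ring G H\<close> to \<open>edge_ring G H\<close> given on variables by
  \<open>Phi_Var\<close>.
\<close>

lemma poly_subst_superset:
  assumes "finite A" "Poly_Mapping.keys p \<subseteq> A"
  shows "poly_subst f p = (\<Sum>m\<in>A. Const (Poly_Mapping.lookup p m) * mon_subst f m)"
  unfolding poly_subst_def
  by (rule sum.mono_neutral_left) (use assms in \<open>auto simp: in_keys_iff Const_def\<close>)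

lemma mon_subst_add: "mon_subst f (m + n) = mon_subst f m * mon_subst f n"
proof -
  have ext: "mon_subst f l = (\<Prod>x\<in>Poly_Mapping.keys m \<union> Poly_Mapping.keys n. f x ^ Poly_Mapping.lookup l x)"
    if "Poly_Mapping.keys l \<subseteq> Poly_Mapping.keys m \<union> Poly_Mapping.keys n" for l
    unfolding mon_subst_def
    by (rule prod.mono_neutral_left) (use that in \<open>auto simp: in_keys_iff\<close>)
  show ?thesis
    by (simp add: ext keys_add lookup_add power_add prod.distrib)
qed

lemma poly_subst_add: "poly_subst f (p + q) = poly_subst f p + poly_subst f q"
proof -
  let ?A = "Poly_Mapping.keys p \<union> Poly_Mapping.keys q"
  have "poly_subst f r = (\<Sum>m\<in>?A. Const (Poly_Mapping.lookup r m) * mon_subst f m)"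
    if "r \<in> {p, q, p + q}" for r
    using that keys_add[of p q] by (intro poly_subst_superset) auto
  then show ?thesis
    by (simp add: lookup_add Const_def single_add distrib_right sum.distrib)
qed

lemma poly_subst_zero: "poly_subst f 0 = 0"
  by (simp add: poly_subst_def)

lemma poly_subst_single: "poly_subst f (Poly_Mapping.single m c) = Const c * mon_subst f m"
  by (subst poly_subst_superset[of "{m}"]) auto

lemma poly_subst_sum: "poly_subst f (\<Sum>i\<in>A. g i) = (\<Sum>i\<in>A. poly_subst f (g i))"
  by (induction A rule: infinite_finite_induct) (auto simp: poly_subst_add poly_subst_zero)

lemma poly_mapping_sum_monomials:
  "(\<Sum>m\<in>Poly_Mapping.keys r. Poly_Mapping.single m (Poly_Mapping.lookup r m)) = r"
  by (rule poly_mapping_eqI) (auto simp: lookup_sum lookup_single when_def in_keys_iff)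

lemma Const_mult: "Const (a * b) = Const a * Const b"
  by (simp add: Const_def mult_single)

lemma poly_subst_mult: "poly_subst f (p * q) = poly_subst f p * poly_subst f q"
proof -
  have "p * q = (\<Sum>m\<in>Poly_Mapping.keys p. Poly_Mapping.single m (Poly_Mapping.lookup p m)) *
                (\<Sum>n\<in>Poly_Mapping.keys q. Poly_Mapping.single n (Poly_Mapping.lookup q n))"
    by (simp only: poly_mapping_sum_monomials)
  also have "\<dots> = (\<Sum>m\<in>Poly_Mapping.keys p. \<Sum>n\<in>Poly_Mapping.keys q.
          Poly_Mapping.single (m + n) (Poly_Mapping.lookup p m * Poly_Mapping.lookup q n))"
    by (simp add: sum_product mult_single)
  finally have "poly_subst f (p * q) = (\<Sum>m\<in>Poly_Mapping.keys p. \<Sum>n\<in>Poly_Mapping.keys q.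
      Const (Poly_Mapping.lookup p m * Poly_Mapping.lookup q n) * mon_subst f (m + n))"
    by (simp add: poly_subst_sum poly_subst_single)
  also have "\<dots> = poly_subst f p * poly_subst f q"
    by (simp add: poly_subst_def sum_product mon_subst_add Const_mult mult_ac)
  finally show ?thesis .
qed

lemma Phi_add: "Phi G (p + q) = Phi G p + Phi G q"
  by (simp add: Phi_def poly_subst_add)

lemma Phi_mult: "Phi G (p * q) = Phi G p * Phi G q"
  by (simp add: Phi_def poly_subst_mult)

lemma Phi_Const: "Phi G (Const c) = Const c"
  unfolding Phi_def Const_def[of c] poly_subst_single by (simp add: mon_subst_def Const_def)

lemma Phi_Var: "Phi G (Var \<phi>) = (\<Prod>e\<in>edges G. Var (e, restrict \<phi> e))"
  unfolding Phi_def Var_def[of \<phi>] poly_subst_single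
  by (simp add: mon_subst_def Const_def)

lemma poly_ring_add: "p \<in> poly_ring X \<Longrightarrow> q \<in> poly_ring X \<Longrightarrow> p + q \<in> poly_ring X"
  using keys_add[of p q] by (auto simp: poly_ring_def)

lemma poly_ring_mult:
  assumes "p \<in> poly_ring X" "q \<in> poly_ring X"
  shows "p * q \<in> poly_ring X"
  unfolding poly_ring_def
proof (intro CollectI ballI)
  fix l assume "l \<in> Poly_Mapping.keys (p * q)"
  then obtain m n where "l = m + n" "m \<in> Poly_Mapping.keys p" "n \<in> Poly_Mapping.keys q"
    using keys_mult[of p q] by blast
  moreover have "Poly_Mapping.keys m \<subseteq> X" "Poly_Mapping.keys n \<subseteq> X"
    using assms calculation by (simp_all add: poly_ring_def)
  ultimately show "Poly_Mapping.keys l \<subseteq> X"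
    using keys_add[of m n] by blast
qed

lemma poly_ring_Const: "Const c \<in> poly_ring X"
  by (auto simp: poly_ring_def Const_def)

lemma poly_ring_Var: "x \<in> X \<Longrightarrow> Var x \<in> poly_ring X"
  by (auto simp: poly_ring_def Var_def)

lemma poly_ring_zero: "0 \<in> poly_ring X"
  by (simp add: poly_ring_def)

lemma poly_ring_sum: "(\<And>i. i \<in> A \<Longrightarrow> g i \<in> poly_ring X) \<Longrightarrow> (\<Sum>i\<in>A. g i) \<in> poly_ring X"
  by (induction A rule: infinite_finite_induct) (auto intro: poly_ring_add poly_ring_zero)

lemma poly_ring_one: "1 \<in> poly_ring X"
  by (auto simp: poly_ring_def)

lemma poly_ring_prod: "(\<And>i. i \<in> A \<Longrightarrow> g i \<in> poly_ring X) \<Longrightarrow> (\<Prod>i\<in>A. g i) \<in> poly_ring X"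
  by (induction A rule: infinite_finite_induct) (auto intro: poly_ring_mult poly_ring_one)

lemma poly_ring_power: "p \<in> poly_ring X \<Longrightarrow> p ^ n \<in> poly_ring X"
  by (induction n) (auto intro: poly_ring_mult poly_ring_one)

lemma Hom_restrict:
  assumes "is_graph G" "\<phi> \<in> Hom G H" "e \<in> edges G"
  shows "restrict \<phi> e \<in> Hom (edge_subgraph e) H"
proof -
  have "e \<subseteq> verts G"
    using assms(1,3) by (simp add: is_graph_def)
  then have "restrict \<phi> e \<in> e \<rightarrow>\<^sub>E verts H"
    using assms(2) by (auto simp: Hom_def)
  moreover have "{restrict \<phi> e u, restrict \<phi> e v} \<in> edges H" if "{u, v} = e" for u v
    using that assms(2,3) by (auto simp: Hom_def)
  ultimately show ?thesis
    by (simp add: Hom_def edge_subgraph_def)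
qed

lemma poly_subst_in_poly_ring:
  assumes "p \<in> poly_ring X" "\<And>x. x \<in> X \<Longrightarrow> f x \<in> poly_ring Y"
  shows "poly_subst f p \<in> poly_ring Y"
proof -
  have "mon_subst f m \<in> poly_ring Y" if "m \<in> Poly_Mapping.keys p" for m
    unfolding mon_subst_def
  proof (rule poly_ring_prod)
    fix x assume "x \<in> Poly_Mapping.keys m"
    then have "x \<in> X"
      using assms(1) that by (auto simp: poly_ring_def)
    then show "f x ^ Poly_Mapping.lookup m x \<in> poly_ring Y"
      by (rule poly_ring_power[OF assms(2)])
  qed
  then show ?thesis
    unfolding poly_subst_def by (rule poly_ring_sum[OF poly_ring_mult[OF poly_ring_Const]])
qed

lemma Phi_in_edge_ring:
  assumes "is_graph G" "p \<in> hom_ring G H"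
  shows "Phi G p \<in> edge_ring G H"
  unfolding Phi_def edge_ring_def
proof (rule poly_subst_in_poly_ring)
  show "p \<in> poly_ring (Hom G H)"
    using assms(2) by (simp add: hom_ring_def)
next
  fix \<phi> assume \<phi>: "\<phi> \<in> Hom G H"
  show "(\<Prod>e\<in>edges G. Var (e, restrict \<phi> e))
          \<in> poly_ring (SIGMA e:edges G. Hom (edge_subgraph e) H)"
  proof (rule poly_ring_prod)
    fix e assume "e \<in> edges G"
    then show "Var (e, restrict \<phi> e) \<in> poly_ring (SIGMA e:edges G. Hom (edge_subgraph e) H)"
      using Hom_restrict[OF assms(1) \<phi>] by (intro poly_ring_Var) simp
  qed
qed

end

theory Submission
  imports Defs
begin

text \<open>
  Membership in the ideal says that both families have the same multiset of restrictions to each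
  edge of \<open>K\<^sub>3\<close>. After colouring, let \<open>D\<close> be the difference of the multiplicities of the rainbow
  triples over four colours. A pair of distinct colours extends to a rainbow triple in exactly two
  ways, so \<open>D\<close> changes sign whenever an entry of a triple is replaced by the missing colour.
  Identifying rainbow triples with permutations of the colours, \<open>D\<close> is a multiple of the sign
  character; if it does not vanish, then each family contains at least \<open>12\<close> different triples.
\<close>

lemma prod_single_one:
  "(\<Prod>i\<in>A. Poly_Mapping.single (m i) 1) = Poly_Mapping.single (\<Sum>i\<in>A. m i) (1::'k::comm_semiring_1)"
  by (induction A rule: infinite_finite_induct) (auto simp: mult_single)

lemma Phi_prod: "Phi F (\<Prod>i\<in>A. f i) = (\<Prod>i\<in>A. Phi F (f i))"
proof -
  have "Phi F 1 = 1"
    using Phi_Const[of F 1] by (simp add: Const_def)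
  then show ?thesis
    by (induction A rule: infinite_finite_induct) (auto simp: Phi_mult)
qed

text \<open>Monomials go to monic monomials, so comparing images reduces to comparing
  exponents.\<close>

lemma Phi_prod_Var:
  "Phi F (\<Prod>i\<in>A. Var (f i))
     = Poly_Mapping.single
         (\<Sum>i\<in>A. \<Sum>e\<in>edges F. Poly_Mapping.single (e, restrict (f i) e) 1) 1"
  unfolding Phi_prod Phi_Var by (simp only: Var_def prod_single_one)

text \<open>Both monomials have monic monomial images, which cancel only if their exponents agree.
  The exponent of the variable \<open>(e, \<psi>)\<close> counts the indices whose map restricts to
  \<open>\<psi>\<close> on \<open>e\<close>.\<close>

lemma hom_ideal_binomialD:
  fixes f g :: "'i \<Rightarrow> 'a \<Rightarrow> 'b"
  assumes "finite (edges F)" "e \<in> edges F" "finite A"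
    and ideal: "(\<Prod>i\<in>A. Var (f i)) - (\<Prod>i\<in>A. Var (g i)) \<in> (hom_ideal F G :: ('a \<Rightarrow> 'b, 'k::field) mpoly set)"
  shows "image_mset (\<lambda>i. restrict (f i) e) (mset_set A) = image_mset (\<lambda>i. restrict (g i) e) (mset_set A)"
proof (rule multiset_eqI)
  fix \<psi>
  let ?m = "\<lambda>h :: 'i \<Rightarrow> 'a \<Rightarrow> 'b. \<Sum>i\<in>A. \<Sum>e\<in>edges F. Poly_Mapping.single (e, restrict (h i) e) (1::nat)"
  let ?p = "\<lambda>h. (\<Prod>i\<in>A. Var (h i)) :: ('a \<Rightarrow> 'b, 'k) mpoly"
  have count: "Poly_Mapping.lookup (?m h) (e, \<psi>) = count (image_mset (\<lambda>i. restrict (h i) e) (mset_set A)) \<psi>"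
    for h
  proof -
    have "Poly_Mapping.lookup (\<Sum>e\<in>edges F. Poly_Mapping.single (e, restrict (h i) e) (1::nat)) (e, \<psi>)
            = (if restrict (h i) e = \<psi> then 1 else 0)" for i
    proof -
      \<comment> \<open>The variables are tagged with their edge, so only the summand of
        \<open>e\<close> itself contributes.\<close>
      have "Poly_Mapping.lookup (\<Sum>e\<in>edges F. Poly_Mapping.single (e, restrict (h i) e) (1::nat)) (e, \<psi>)
              = (\<Sum>e'\<in>edges F. if e' = e then (if restrict (h i) e = \<psi> then 1 else 0) else 0)"
        unfolding lookup_sum by (rule sum.cong) (auto simp: lookup_single when_def)
      then show ?thesis
        using assms(1,2) by simp
    qed
    then have "Poly_Mapping.lookup (?m h) (e, \<psi>) = (\<Sum>i\<in>A. if restrict (h i) e = \<psi> then 1 else 0)"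
      by (simp add: lookup_sum)
    also have "\<dots> = count (image_mset (\<lambda>i. restrict (h i) e) (mset_set A)) \<psi>"
      using assms(3) by induction auto
    finally show ?thesis .
  qed
  have "Phi F (?p f) = Phi F (?p f - ?p g) + Phi F (?p g)"
    by (simp flip: Phi_add)
  then have "Phi F (?p f) = Phi F (?p g)"
    using ideal by (simp add: hom_ideal_def)
  \<comment> \<open>The coefficient at \<open>?m f\<close> is 1 on the left; on the right it is 0
    unless \<open>?m g = ?m f\<close>.\<close>
  then have "Poly_Mapping.lookup (Poly_Mapping.single (?m f) (1::'k)) (?m f)
      = Poly_Mapping.lookup (Poly_Mapping.single (?m g) 1) (?m f)"
    by (simp only: Phi_prod_Var)
  then have "?m f = ?m g"
    by (simp add: lookup_single when_def split: if_splits)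
  then show "count (image_mset (\<lambda>i. restrict (f i) e) (mset_set A)) \<psi>
      = count (image_mset (\<lambda>i. restrict (g i) e) (mset_set A)) \<psi>"
    by (simp flip: count)
qed

definition rainbow_triples :: "'c set \<Rightarrow> ('c \<times> 'c \<times> 'c) set" where
  "rainbow_triples C = {(x, y, z). {x, y, z} \<subseteq> C \<and> x \<noteq> y \<and> x \<noteq> z \<and> y \<noteq> z}"

text \<open>Meant for projections of rainbow triples to two entries, whose fibres over four colours
  have two elements. Either of \<open>s\<close>, \<open>s'\<close> may have multiplicity 0 in
  \<open>A\<close>.\<close>

lemma count_image_mset_pair:
  assumes "\<And>t. t \<in># A \<Longrightarrow> f t = u \<Longrightarrow> t = s \<or> t = s'" "f s = u" "f s' = u" "s \<noteq> s'"
  shows "count (image_mset f A) u = count A s + count A s'"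
proof -
  have "count (image_mset f A) u = (\<Sum>t\<in>{s, s'}. count A t)"
    unfolding count_image_mset
    by (rule sum.mono_neutral_left) (use assms in \<open>auto simp: not_in_iff\<close>)
  then show ?thesis
    using assms(4) by simp
qed

lemma card_set_mset_le_size: "card (set_mset A) \<le> size A"
proof (induction A)
  case (add x A)
  then show ?case
    using card_insert_le_m1[of "Suc (size A)" "set_mset A" x] by simp
qed simp

text \<open>Each side counts one pair of colours through its two rainbow completions. Sums instead
  of differences keep the sign change within the natural numbers.\<close>

lemma flip_counts:
  fixes A B :: "('c \<times> 'c \<times> 'c) multiset"
  assumes A: "set_mset A \<subseteq> rainbow_triples {p, q, r, s}"
    and B: "set_mset B \<subseteq> rainbow_triples {p, q, r, s}" and d: "distinct [p, q, r, s]"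
  shows
    "image_mset (\<lambda>(x, y, z). (x, y)) A = image_mset (\<lambda>(x, y, z). (x, y)) B \<Longrightarrow>
       count A (p, q, r) + count A (p, q, s) = count B (p, q, r) + count B (p, q, s)"
    "image_mset (\<lambda>(x, y, z). (x, z)) A = image_mset (\<lambda>(x, y, z). (x, z)) B \<Longrightarrow>
       count A (p, q, r) + count A (p, s, r) = count B (p, q, r) + count B (p, s, r)"
    "image_mset (\<lambda>(x, y, z). (y, z)) A = image_mset (\<lambda>(x, y, z). (y, z)) B \<Longrightarrow>
       count A (p, q, r) + count A (s, q, r) = count B (p, q, r) + count B (s, q, r)"
proof -
  have "count (image_mset (\<lambda>(x, y, z). (x, y)) M) (p, q) = count M (p, q, r) + count M (p, q, s)"
    and "count (image_mset (\<lambda>(x, y, z). (x, z)) M) (p, r) = count M (p, q, r) + count M (p, s, r)"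
    and "count (image_mset (\<lambda>(x, y, z). (y, z)) M) (q, r) = count M (p, q, r) + count M (s, q, r)"
    if M: "set_mset M \<subseteq> rainbow_triples {p, q, r, s}" for M
    by (rule count_image_mset_pair; use d M in \<open>auto simp: rainbow_triples_def\<close>)+
  note marginals = this
  show "image_mset (\<lambda>(x, y, z). (x, y)) A = image_mset (\<lambda>(x, y, z). (x, y)) B \<Longrightarrow>
       count A (p, q, r) + count A (p, q, s) = count B (p, q, r) + count B (p, q, s)"
    using marginals(1)[OF A] marginals(1)[OF B] by simp
  show "image_mset (\<lambda>(x, y, z). (x, z)) A = image_mset (\<lambda>(x, y, z). (x, z)) B \<Longrightarrow>
       count A (p, q, r) + count A (p, s, r) = count B (p, q, r) + count B (p, s, r)"
    using marginals(2)[OF A] marginals(2)[OF B] by simp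
  show "image_mset (\<lambda>(x, y, z). (y, z)) A = image_mset (\<lambda>(x, y, z). (y, z)) B \<Longrightarrow>
       count A (p, q, r) + count A (s, q, r) = count B (p, q, r) + count B (s, q, r)"
    using marginals(3)[OF A] marginals(3)[OF B] by simp
qed

text \<open>Two flips preserve the sign of the difference, so an excess of \<open>A\<close> at
  \<open>t\<close> spreads to the 12 triples of the same parity, too many for \<open>A\<close>. The
  bound is one-sided; exchanging \<open>A\<close> and \<open>B\<close> gives equality.\<close>

lemma rainbow_count_le:
  fixes A B :: "('c \<times> 'c \<times> 'c) multiset"
  assumes "set_mset A \<subseteq> rainbow_triples C" "set_mset B \<subseteq> rainbow_triples C" "card C = 4"
    and m12: "image_mset (\<lambda>(x, y, z). (x, y)) A = image_mset (\<lambda>(x, y, z). (x, y)) B"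
    and m13: "image_mset (\<lambda>(x, y, z). (x, z)) A = image_mset (\<lambda>(x, y, z). (x, z)) B"
    and m23: "image_mset (\<lambda>(x, y, z). (y, z)) A = image_mset (\<lambda>(x, y, z). (y, z)) B"
    and "size A < 12"
  shows "count A t \<le> count B t"
proof (rule ccontr)
  assume less: "\<not> count A t \<le> count B t"
  obtain x y z where t: "t = (x, y, z)"
    by (cases t)
  have "t \<in># A"
    using less by (auto simp flip: count_greater_zero_iff)
  then have xyz: "{x, y, z} \<subseteq> C" "x \<noteq> y" "x \<noteq> z" "y \<noteq> z"
    using assms(1) by (auto simp: t rainbow_triples_def)
  then have "card (C - {x, y, z}) = 1"
    using assms(3) by (subst card_Diff_subset) auto
  then obtain w where "C - {x, y, z} = {w}"
    by (auto simp: card_1_singleton_iff)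
  then have C: "C = {x, y, z, w}" and w: "w \<noteq> x" "w \<noteq> y" "w \<noteq> z"
    using xyz(1) by auto
  note ne = xyz(2-4) w w[symmetric] xyz(2-4)[symmetric]
  \<comment> \<open>\<open>s\<close> is the colour missing from the triple, so \<open>P\<close>
    speaks of arrangements of all four colours.\<close>
  define P where "P p q r s \<longleftrightarrow> distinct [p, q, r, s] \<and> {p, q, r, s} = C \<and> count B (p, q, r) < count A (p, q, r)"
    for p q r s
  have base: "P x y z w"
    using less ne by (simp add: P_def t C)
  \<comment> \<open>Each shift is two flips, hence a 3-cycle of positions: via
    \<open>(s, q, r)\<close> to \<open>(s, p, r)\<close>, and via \<open>(p, s, r)\<close> to
    \<open>(p, s, q)\<close>.\<close>
  have shift1: "P s p r q" and shift3: "P p s q r" if P: "P p q r s" for p q r s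
  proof -
    have d: "distinct [p, q, r, s]" "distinct [s, q, r, p]" "distinct [p, s, r, q]"
      using P by (auto simp: P_def)
    have C': "C = {p, q, r, s}" "C = {s, q, r, p}" "C = {p, s, r, q}"
      using P by (simp_all add: P_def insert_commute)
    have l: "count B (p, q, r) < count A (p, q, r)"
      using P by (simp add: P_def)
    note A = assms(1)[unfolded C'(1)] assms(1)[unfolded C'(2)] assms(1)[unfolded C'(3)]
    note B = assms(2)[unfolded C'(1)] assms(2)[unfolded C'(2)] assms(2)[unfolded C'(3)]
    note flip_counts(3)[OF A(1) B(1) d(1) m23] flip_counts(2)[OF A(2) B(2) d(2) m13]
      flip_counts(2)[OF A(1) B(1) d(1) m13] flip_counts(1)[OF A(3) B(3) d(3) m12]
    then have "count B (s, p, r) < count A (s, p, r)" "count B (p, s, q) < count A (p, s, q)"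
      using l by linarith+
    moreover have "{s, p, r, q} = C" "{p, s, q, r} = C"
      using C'(1) by (simp_all add: insert_commute)
    ultimately show "P s p r q" "P p s q r"
      using d(1) by (auto simp: P_def)
  qed
  \<comment> \<open>The arrangement runs through \<open>s p r q\<close>, \<open>q s r p\<close>,
    \<open>q p s r\<close> to \<open>q r p s\<close>: the missing colour stays and the triple
    rotates.\<close>
  have rot: "P q r p s" if "P p q r s" for p q r s
    by (rule shift3[OF shift3[OF shift1[OF shift1[OF that]]]])
  have mem: "(p, q, r) \<in># A" if "P p q r s" for p q r s
    using that by (auto simp: P_def simp flip: count_greater_zero_iff)
  have orbit: "{(p, q, r), (q, r, p), (r, p, q)} \<subseteq> set_mset A" if "P p q r s" for p q r s
    using mem[OF that] mem[OF rot[OF that]] mem[OF rot[OF rot[OF that]]] by simp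
  \<comment> \<open>The even arrangements of \<open>x, y, z, w\<close>: one class of three rotations
    for each missing colour, in the order \<open>w, z, y, x\<close>.\<close>
  let ?T = "{(x,y,z), (y,z,x), (z,x,y), (x,w,y), (w,y,x), (y,x,w),
             (x,z,w), (z,w,x), (w,x,z), (y,w,z), (w,z,y), (z,y,w)}"
  have "?T \<subseteq> set_mset A"
    using orbit[OF base] orbit[OF shift3[OF base]] orbit[OF shift3[OF shift3[OF base]]]
      orbit[OF shift1[OF shift1[OF base]]]
    by (simp only: insert_subset empty_subsetI simp_thms)
  then have "card ?T \<le> size A"
    by (rule order.trans[OF card_mono[OF finite_set_mset] card_set_mset_le_size])
  moreover have "card ?T = 12"
    using ne by simp
  ultimately show False
    using assms(7) by simp
qed

theorem proposition11p1:
  fixes G :: "'v ugraph" and \<xi> :: "'v \<Rightarrow> nat" and d :: nat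
    and \<phi> \<phi>' :: "nat \<Rightarrow> (nat \<Rightarrow> 'v)"
  assumes "is_graph G"
    and "\<xi> \<in> Hom G (complete_graph 4)"
    and "\<And>i. i \<in> {1..d} \<Longrightarrow> \<phi> i \<in> Hom (complete_graph 3) G"
    and "\<And>i. i \<in> {1..d} \<Longrightarrow> \<phi>' i \<in> Hom (complete_graph 3) G"
    and "(\<Prod>i\<in>{1..d}. Var (\<phi> i)) - (\<Prod>i\<in>{1..d}. Var (\<phi>' i))
           \<in> (hom_ideal (complete_graph 3) G :: (nat \<Rightarrow> 'v, 'k::field) mpoly set)"
    and "\<not> (\<exists>\<psi> \<in> Hom (complete_graph 3) G.
           (Var \<psi> :: (nat \<Rightarrow> 'v, 'k) mpoly) dvd (\<Prod>i\<in>{1..d}. Var (\<phi> i)) \<and>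
           (Var \<psi> :: (nat \<Rightarrow> 'v, 'k) mpoly) dvd (\<Prod>i\<in>{1..d}. Var (\<phi>' i)))"
    and "d < 12"
  shows "\<exists>\<pi>. \<pi> permutes {1..d} \<and>
    (\<forall>i\<in>{1..d}. compose (verts (complete_graph 3)) \<xi> (\<phi> i)
              = compose (verts (complete_graph 3)) \<xi> (\<phi>' (\<pi> i)))"
proof -
  define I where "I = mset_set {1..d}"
  let ?K = "complete_graph 3"
  have K: "edges ?K = {{1, 2}, {1, 3}, {2, 3}}"
  proof -
    have "{1..3} = {1, 2, 3::nat}"
      by auto
    then have verts: "u \<in> {1..3} \<longleftrightarrow> u = 1 \<or> u = 2 \<or> u = 3" for u :: nat
      by simp
    show ?thesis
      unfolding complete_graph_def verts ugraph.simps by (fastforce simp: doubleton_eq_iff)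
  qed
  define col where "col f = (\<xi> (f 1), \<xi> (f 2), \<xi> (f 3))" for f :: "nat \<Rightarrow> 'v"
  \<comment> \<open>\<open>complete_graph 4\<close> has no loops, so adjacent vertices receive
    different colours.\<close>
  have rainbow: "col f \<in> rainbow_triples {1..4}" if "f \<in> Hom ?K G" for f
  proof -
    have "{\<xi> (f u), \<xi> (f v)} \<in> edges (complete_graph 4)" if "{u, v} \<in> edges ?K" for u v
      using that \<open>f \<in> Hom ?K G\<close> assms(2) by (auto simp: Hom_def)
    then have "{\<xi> (f 1), \<xi> (f 2)} \<in> edges (complete_graph 4)"
      "{\<xi> (f 1), \<xi> (f 3)} \<in> edges (complete_graph 4)"
      "{\<xi> (f 2), \<xi> (f 3)} \<in> edges (complete_graph 4)"
      by (simp_all add: K)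
    then show ?thesis
      by (auto simp: complete_graph_def rainbow_triples_def col_def doubleton_eq_iff)
  qed
  define A where "A = image_mset (\<lambda>i. col (\<phi> i)) I"
  define B where "B = image_mset (\<lambda>i. col (\<phi>' i)) I"
  have pairs: "image_mset (\<lambda>i. (\<xi> (\<phi> i u), \<xi> (\<phi> i v))) I = image_mset (\<lambda>i. (\<xi> (\<phi>' i u), \<xi> (\<phi>' i v))) I"
    if "{u, v} \<in> edges ?K" for u v
  proof -
    have "image_mset (\<lambda>i. restrict (\<phi> i) {u, v}) I = image_mset (\<lambda>i. restrict (\<phi>' i) {u, v}) I"
      unfolding I_def by (rule hom_ideal_binomialD[OF _ that _ assms(5)]) (simp_all add: K)
    \<comment> \<open>The restrictions retain their values at \<open>u\<close> and \<open>v\<close>,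
      so the colours can be read off from them.\<close>
    then have "image_mset (\<lambda>\<psi>. (\<xi> (\<psi> u), \<xi> (\<psi> v))) (image_mset (\<lambda>i. restrict (\<phi> i) {u, v}) I)
        = image_mset (\<lambda>\<psi>. (\<xi> (\<psi> u), \<xi> (\<psi> v))) (image_mset (\<lambda>i. restrict (\<phi>' i) {u, v}) I)"
      by simp
    then show ?thesis
      by (simp add: multiset.map_comp comp_def)
  qed
  have sub: "set_mset A \<subseteq> rainbow_triples {1..4}" "set_mset B \<subseteq> rainbow_triples {1..4}"
    using rainbow assms(3,4) by (auto simp: A_def B_def I_def)
  have size: "size A < 12" "size B < 12"
    using assms(7) by (simp_all add: A_def B_def I_def)
  have marginals:
    "image_mset (\<lambda>(x, y, z). (x, y)) A = image_mset (\<lambda>(x, y, z). (x, y)) B"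
    "image_mset (\<lambda>(x, y, z). (x, z)) A = image_mset (\<lambda>(x, y, z). (x, z)) B"
    "image_mset (\<lambda>(x, y, z). (y, z)) A = image_mset (\<lambda>(x, y, z). (y, z)) B"
    using pairs[of 1 2] pairs[of 1 3] pairs[of 2 3]
    by (simp_all add: K A_def B_def multiset.map_comp comp_def col_def)
  have "A = B"
  proof (rule multiset_eqI)
    fix t
    show "count A t = count B t"
      using rainbow_count_le[OF sub _ marginals size(1), of t]
        rainbow_count_le[OF sub(2,1) _ marginals[symmetric] size(2), of t] by simp
  qed
  then obtain \<pi> where \<pi>: "\<pi> permutes {1..d}" "\<forall>i\<in>{1..d}. col (\<phi> i) = col (\<phi>' (\<pi> i))"
    using image_mset_eq_implies_permutes[of "{1..d}" "\<lambda>i. col (\<phi> i)" "\<lambda>i. col (\<phi>' i)"]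
    unfolding A_def B_def I_def by blast
  \<comment> \<open>Off the vertices 1, 2, 3 both composites are \<open>undefined\<close>, so
    \<open>col\<close> determines them.\<close>
  moreover have "compose (verts ?K) \<xi> f = compose (verts ?K) \<xi> g" if "col f = col g" for f g
  proof -
    have "\<xi> (f v) = \<xi> (g v)" if "v \<in> verts ?K" for v
    proof -
      have "v = 1 \<or> v = 2 \<or> v = 3"
        using that by (auto simp: complete_graph_def)
      then show ?thesis
        using \<open>col f = col g\<close> by (auto simp: col_def)
    qed
    then show ?thesis
      by (simp add: compose_def restrict_def fun_eq_iff)
  qed
  ultimately show ?thesis
    by blast
qed

end
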